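(* Let $\mathcal X(p)\subset\mathbb R^p$ be bounded, and let $\phi$ be a continuous distribution on $\mathcal X(p)$. Then $B\subset\mathcal X(p)$ is the unique $\beta$-mode of $\phi$ if and only if $B$ maximizes the active information of $\phi$ with respect to the uniform distribution $\mathbf U$ on $\mathcal X(p)$ among all the events of $\mathcal X(p)$ with $\phi$-probability $\beta$.
   Context: $\mathcal X(p)$ is the $p$-dimensional input space, $\mathrm{Vol}$ denotes $p$-dimensional volume (Lebesgue measure), and $\beta>0$ is a fixed probability. A $\beta$-mode of a continuous distribution $\phi$ is a region of the space with the smallest volume subject to having $\phi$-probability $\beta$. There may in general be more than one $\beta$-mode. The distribution $\phi$ is called $\beta$-unimodal with $\beta$-mode $B$ (so that one may speak of "the" $\beta$-mode) if for any other $\beta$-mode $B'$ the symmetric difference satisfies $\mathrm{Vol}(B\triangle B')=0$; in that case either $B$ or $B'$ can be taken as the $\beta$-mode. For two continuous distributions $\phi,\psi$ on $\mathcal X(p)$ and an event $R\subset\mathcal X(p)$ with positive probability under both, the active information of $\phi$ with respect to $\psi$ for $R$ is $\mathbf I_+(R)=\log\frac{\phi(R)}{\psi(R)}$. In the claim, $\psi=\mathbf U$.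
   Formalization: As stated, "if" fails when φ has several β-modes (e.g. φ = U): a maximizer need not be a unique mode. Proved instead: unique β-mode iff unique maximizer up to null sets, and the literal claim for β-unimodal φ. X is Borel; "continuous" means φ has a density. *)

theory Defs
  imports "HOL-Probability.Probability"
begin

text \<open>
  Distributions on \<open>X\<close> live on the Borel subsets of \<open>X\<close>, so the events are the elements of
  \<open>sets \<phi>\<close>, all of them subsets of \<open>X\<close>.  ``Continuous'' means having a density with respect to
  Lebesgue measure; in particular an event of positive \<open>\<phi>\<close>-probability has positive volume.
\<close>

definition continuous_distribution_on :: "'a::euclidean_space set \<Rightarrow> 'a measure \<Rightarrow> bool" where
  "continuous_distribution_on X \<phi> \<longleftrightarrow> prob_space \<phi> \<and>
     (\<exists>f \<in> borel_measurable (restrict_space lborel X). \<phi> = density (restrict_space lborel X) f)"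

definition uniform_distribution_on :: "'a::euclidean_space set \<Rightarrow> 'a measure" where
  "uniform_distribution_on X = uniform_measure (restrict_space lborel X) X"

abbreviation Vol :: "'a::euclidean_space set \<Rightarrow> ennreal" where
  "Vol \<equiv> emeasure lborel"

definition event_of_prob :: "'a measure \<Rightarrow> real \<Rightarrow> 'a set \<Rightarrow> bool" where
  "event_of_prob \<phi> \<beta> R \<longleftrightarrow> R \<in> sets \<phi> \<and> measure \<phi> R = \<beta>"

definition beta_mode :: "'a::euclidean_space measure \<Rightarrow> real \<Rightarrow> 'a set \<Rightarrow> bool" where
  "beta_mode \<phi> \<beta> B \<longleftrightarrow> is_arg_min Vol (event_of_prob \<phi> \<beta>) B"

text \<open>Uniqueness of the mode is up to Lebesgue null sets.\<close>

definition unique_beta_mode :: "'a::euclidean_space measure \<Rightarrow> real \<Rightarrow> 'a set \<Rightarrow> bool" where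
  "unique_beta_mode \<phi> \<beta> B \<longleftrightarrow>
     beta_mode \<phi> \<beta> B \<and> (\<forall>B'. beta_mode \<phi> \<beta> B' \<longrightarrow> Vol (sym_diff B B') = 0)"

definition beta_unimodal :: "'a::euclidean_space measure \<Rightarrow> real \<Rightarrow> bool" where
  "beta_unimodal \<phi> \<beta> \<longleftrightarrow> (\<exists>B. unique_beta_mode \<phi> \<beta> B)"

text \<open>
  Meaningful only for events of positive probability under both measures.  For \<open>\<beta> > 0\<close>, a
  continuous distribution \<open>\<phi>\<close> on \<open>X\<close> and \<open>\<psi>\<close> uniform on \<open>X\<close>, every event of \<open>\<phi>\<close>-probability \<open>\<beta>\<close>
  is of this kind.
\<close>

definition active_information :: "'a measure \<Rightarrow> 'a measure \<Rightarrow> 'a set \<Rightarrow> real" where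
  "active_information \<phi> \<psi> R = ln (measure \<phi> R / measure \<psi> R)"

definition maximizes_active_information ::
    "'a measure \<Rightarrow> 'a measure \<Rightarrow> real \<Rightarrow> 'a set \<Rightarrow> bool" where
  "maximizes_active_information \<phi> \<psi> \<beta> B \<longleftrightarrow>
     is_arg_max (active_information \<phi> \<psi>) (event_of_prob \<phi> \<beta>) B"

text \<open>
  Maximizers, like modes, are determined at best up to null sets, so a maximizer is unique if it
  agrees with every other one up to a null set.
\<close>

definition uniquely_maximizes_active_information ::
    "'a::euclidean_space measure \<Rightarrow> 'a measure \<Rightarrow> real \<Rightarrow> 'a set \<Rightarrow> bool" where
  "uniquely_maximizes_active_information \<phi> \<psi> \<beta> B \<longleftrightarrow>
     maximizes_active_information \<phi> \<psi> \<beta> B \<and>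
     (\<forall>B'. maximizes_active_information \<phi> \<psi> \<beta> B' \<longrightarrow> Vol (sym_diff B B') = 0)"

end

theory Submission
  imports Defs
begin

text \<open>Among events of \<phi>-probability \<beta>, the numerator of the active information is
  the constant \<beta>, while the uniform probability of \<open>R\<close> is
  \<open>Vol R / Vol X\<close>. So the active information is
  \<open>ln (\<beta> * Vol X / Vol R)\<close>, strictly decreasing in the volume
  (\<open>active_information_uniform_less_iff\<close>). Minimizing volume and maximizing active
  information are thus the same problem (\<open>beta_mode_iff_maximizes_active_information\<close>),
  and the two uniqueness clauses coincide. If \<phi> is \<beta>-unimodal, any single mode is already
  unique up to null sets (\<open>beta_unimodal_imp_unique\<close>), so plain maximization
  suffices.\<close>

lemma continuous_distribution_on_sets:
  assumes "continuous_distribution_on X \<phi>" "X \<in> sets borel"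
  shows "sets \<phi> = {R. R \<in> sets borel \<and> R \<subseteq> X}"
proof -
  have "sets \<phi> = sets (restrict_space lborel X)"
    using assms(1) by (auto simp: continuous_distribution_on_def)
  also have "\<dots> = {R. R \<in> sets borel \<and> R \<subseteq> X}"
    using assms(2) by (auto simp: sets_restrict_space_iff)
  finally show ?thesis .
qed

text \<open>Absolute continuity, from the density. Its contrapositive gives events of probability
  \<beta> > 0 positive volume, which keeps the logarithm meaningful.\<close>

lemma continuous_distribution_on_null:
  assumes "continuous_distribution_on X \<phi>" "X \<in> sets borel" "R \<in> sets \<phi>" "Vol R = 0"
  shows "measure \<phi> R = 0"
proof -
  let ?L = "restrict_space lborel X"
  obtain f where f: "f \<in> borel_measurable ?L" "\<phi> = density ?L f"
    using assms(1) by (auto simp: continuous_distribution_on_def)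
  have "R \<in> null_sets ?L"
    using assms continuous_distribution_on_sets[OF assms(1,2)] f
    by (auto simp: null_sets_def emeasure_restrict_space)
  then have "R \<in> null_sets \<phi>"
    using absolutely_continuousI_density[OF f(1)] f(2) by (auto simp: absolutely_continuous_def)
  then show ?thesis by (simp add: null_sets_def measure_def)
qed

lemma measure_uniform_distribution_on:
  assumes "bounded X" "X \<in> sets borel" "R \<in> sets borel" "R \<subseteq> X"
  shows "measure (uniform_distribution_on X) R = measure lborel R / measure lborel X"
proof -
  let ?L = "restrict_space lborel X"
  have sets: "X \<in> sets ?L" "R \<in> sets ?L"
    using assms by (auto simp: sets_restrict_space_iff)
  have vol: "Vol T = ennreal (measure lborel T)" if "T \<subseteq> X" for T
    using emeasure_bounded_finite[OF bounded_subset[OF assms(1) that]]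
    by (intro emeasure_eq_ennreal_measure) auto
  have "Vol R \<le> Vol X"
    using assms by (intro emeasure_mono) auto
  then have le: "measure lborel R \<le> measure lborel X"
    using vol[of R] vol[of X] assms by simp
  have "measure (uniform_distribution_on X) R = enn2real (Vol R / Vol X)"
    using assms sets
    by (simp add: uniform_distribution_on_def measure_def emeasure_restrict_space Int_absorb1)
  \<comment> \<open>If \<open>X\<close> is null then so is \<open>R\<close>, and both sides are 0
    because \<open>0 / 0 = 0\<close> in \<open>ennreal\<close> as well as in
    \<open>real\<close>.\<close>
  also have "\<dots> = measure lborel R / measure lborel X"
    using le vol[of R] vol[of X] assms(4) measure_nonneg[of lborel R]
    by (cases "measure lborel X = 0") (auto simp: divide_ennreal zero_less_measure_iff)
  finally show ?thesis .
qed

text \<open>Monotonicity of \<open>ln\<close> on positive ratios with a common numerator. The strict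
  form matches \<open>is_arg_min\<close> and \<open>is_arg_max\<close>, which say that no strictly
  better candidate exists.\<close>

lemma active_information_uniform_less_iff:
  assumes "bounded X" "X \<in> sets borel" "continuous_distribution_on X \<phi>" "0 < \<beta>"
    and R: "event_of_prob \<phi> \<beta> R" and S: "event_of_prob \<phi> \<beta> S"
  shows "active_information \<phi> (uniform_distribution_on X) R
           < active_information \<phi> (uniform_distribution_on X) S \<longleftrightarrow> Vol S < Vol R"
proof -
  have fin: "Vol T < \<infinity>" if "T \<subseteq> X" for T
    using emeasure_bounded_finite[OF bounded_subset[OF assms(1) that]] .
  \<comment> \<open>Boundedness of \<open>X\<close> makes the volume finite;
    \<open>\<beta> > 0\<close> makes it nonzero.\<close>
  have event: "T \<in> sets borel \<and> T \<subseteq> X \<and> Vol T = ennreal (measure lborel T) \<and> 0 < measure lborel T"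
    if "event_of_prob \<phi> \<beta> T" for T
  proof -
    have T: "T \<in> sets \<phi>" "T \<in> sets borel" "T \<subseteq> X" "measure \<phi> T = \<beta>"
      using that continuous_distribution_on_sets[OF assms(3,2)] by (auto simp: event_of_prob_def)
    have vol: "Vol T = ennreal (measure lborel T)"
      using fin[OF T(3)] by (intro emeasure_eq_ennreal_measure) auto
    moreover have "Vol T \<noteq> 0"
      using continuous_distribution_on_null[OF assms(3,2) T(1)] T(4) assms(4) by auto
    ultimately show ?thesis
      using T by (auto simp: zero_less_measure_iff)
  qed
  note r = event[OF R] and s = event[OF S]
  \<comment> \<open>\<open>X\<close> inherits positive volume from the event \<open>R\<close> inside
    it.\<close>
  have "measure lborel R \<le> measure lborel X"
    using r fin[of X] assms(2) by (intro measure_mono_fmeasurable) (auto simp: fmeasurable_def)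
  with r have X: "0 < measure lborel X" by linarith
  have "active_information \<phi> (uniform_distribution_on X) T = ln (\<beta> * measure lborel X / measure lborel T)"
    if "event_of_prob \<phi> \<beta> T" for T
    using that event[OF that] measure_uniform_distribution_on[OF assms(1,2), of T]
    by (simp add: active_information_def event_of_prob_def)
  then show ?thesis
    using R S r s X assms(4) by (simp add: ennreal_less_iff divide_less_cancel frac_less2 field_simps)
qed

lemma beta_mode_iff_maximizes_active_information:
  assumes "bounded X" "X \<in> sets borel" "continuous_distribution_on X \<phi>" "0 < \<beta>"
  shows "beta_mode \<phi> \<beta> B \<longleftrightarrow> maximizes_active_information \<phi> (uniform_distribution_on X) \<beta> B"
  unfolding beta_mode_def maximizes_active_information_def is_arg_min_def is_arg_max_def
  using active_information_uniform_less_iff[OF assms] by blast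

text \<open>Being equal up to a null set is transitive: two modes that both agree with the witness
  \<open>C\<close> agree with each other. Borel measurability of the modes lets null sets pass to
  subsets.\<close>

lemma beta_unimodal_imp_unique:
  assumes "beta_unimodal \<phi> \<beta>" "sets \<phi> \<subseteq> sets borel" "beta_mode \<phi> \<beta> B"
  shows "unique_beta_mode \<phi> \<beta> B"
proof -
  obtain C where C: "beta_mode \<phi> \<beta> C" "\<And>B'. beta_mode \<phi> \<beta> B' \<Longrightarrow> Vol (sym_diff C B') = 0"
    using assms(1) by (auto simp: beta_unimodal_def unique_beta_mode_def)
  have borel: "B' \<in> sets borel" if "beta_mode \<phi> \<beta> B'" for B'
    using that assms(2) by (auto simp: beta_mode_def is_arg_min_def event_of_prob_def)
  have null: "sym_diff C B' \<in> null_sets lborel" if "beta_mode \<phi> \<beta> B'" for B'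
    using C that borel[OF that] borel[OF C(1)] by (auto simp: null_sets_def)
  have "Vol (sym_diff B B') = 0" if B': "beta_mode \<phi> \<beta> B'" for B'
  proof -
    \<comment> \<open>This union covers \<open>sym_diff B B'\<close>: a point in just one of
      \<open>B\<close>, \<open>B'\<close> is on the other side of \<open>C\<close> from one of
      them.\<close>
    have "sym_diff C B \<union> sym_diff C B' \<in> null_sets lborel"
      using null[OF assms(3)] null[OF B'] by (rule null_sets.Un)
    then have "sym_diff B B' \<in> null_sets lborel"
      by (rule null_sets_subset) (use borel assms(3) B' in auto)
    then show ?thesis by auto
  qed
  with assms(3) show ?thesis by (simp add: unique_beta_mode_def)
qed

theorem theorem1:
  fixes X B :: "(real ^ 'p) set" and \<phi> :: "(real ^ 'p) measure" and \<beta> :: real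
  assumes "bounded X" and "X \<in> sets borel"
    and "continuous_distribution_on X \<phi>"
    and "0 < \<beta>" and "\<beta> \<le> 1"
    and "B \<subseteq> X"
  shows "(unique_beta_mode \<phi> \<beta> B \<longleftrightarrow>
            uniquely_maximizes_active_information \<phi> (uniform_distribution_on X) \<beta> B) \<and>
         (beta_unimodal \<phi> \<beta> \<longrightarrow>
            (unique_beta_mode \<phi> \<beta> B \<longleftrightarrow>
             maximizes_active_information \<phi> (uniform_distribution_on X) \<beta> B))"
proof -
  note mode_iff = beta_mode_iff_maximizes_active_information[OF assms(1-4)]
  have "sets \<phi> \<subseteq> sets borel"
    using continuous_distribution_on_sets[OF assms(3,2)] by auto
  \<comment> \<open>Unimodality makes the uniqueness clause automatic, which reduces the second
    conjunct to \<open>mode_iff\<close>.\<close>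
  then have "unique_beta_mode \<phi> \<beta> B \<longleftrightarrow> beta_mode \<phi> \<beta> B" if "beta_unimodal \<phi> \<beta>"
    using beta_unimodal_imp_unique[OF that] by (auto simp: unique_beta_mode_def)
  then show ?thesis
    by (simp add: mode_iff unique_beta_mode_def uniquely_maximizes_active_information_def)
qed

end
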